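(* Fix integers $p\ge 1$ and $q\ge 2$. For each integer $n\ge 1$, let $$\mathcal{K}_{n,p,q} := \{A\subset\{1,\ldots,n\} : \text{either } A=\emptyset \text{ or } (\max A - \max_2 A = p \text{ and } \min A\ge |A|\ge q)\}.$$ Then for all $n\ge 1$, $$|\mathcal{K}_{n,p,q}| = \begin{cases} 1 & \text{if } 1\le n\le p+2q-3,\\ |\mathcal{K}_{n-1,p,q}| + |\mathcal{K}_{n-2,p,q}| + \binom{n-p-q}{q-2} - 1 & \text{if } n> p+2q-3.\end{cases}$$
   Context: For a finite set $A$ of positive integers with $|A|\ge 2$, $\max_2 A$ denotes the second largest element of $A$. $|A|$ denotes the cardinality of $A$. *)

theory Defs
  imports Main
begin

text \<open>Meaningful for finite sets with at least two elements.\<close>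

definition max2 :: "nat set \<Rightarrow> nat" where
  "max2 A = Max (A - {Max A})"

text \<open>The difference \<open>Max A - max2 A\<close> is never truncated when \<open>card A \<ge> 2\<close>; for \<open>q \<ge> 2\<close>
  the condition \<open>card A \<ge> q\<close> excludes the singletons, where \<^const>\<open>max2\<close> is unspecified.\<close>

definition K :: "nat \<Rightarrow> nat \<Rightarrow> nat \<Rightarrow> nat set set" where
  "K n p q = {A. A \<subseteq> {1..n} \<and>
     (A = {} \<or> (Max A - max2 A = p \<and> Min A \<ge> card A \<and> card A \<ge> q))}"

end

theory Submission
  imports Defs
begin

text \<open>
  Removing the maximum turns a nonempty \<open>A\<close> in \<open>K n p q\<close> with \<open>card A = k\<close> into an arbitrary
  \<open>(k - 1)\<close>-subset \<open>B\<close> of \<open>{k..n - p}\<close>, and \<open>A\<close> is recovered by adjoining \<open>Max B + p\<close>.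
  So \<open>card (K n p q)\<close> is one plus a diagonal sum of binomial coefficients, to which Pascal's
  rule applies termwise; the index shift leaves over the term for \<open>k = q\<close>.
\<close>

definition adjoin_above :: "nat \<Rightarrow> nat set \<Rightarrow> nat set" where
  "adjoin_above p B = insert (Max B + p) B"

text \<open>With \<open>N = n - p\<close>, the summand at \<open>k\<close> counts the
  \<open>(k - 1)\<close>-subsets of \<open>{k..N}\<close>, hence the members of
  \<open>K n p q\<close> of cardinality \<open>k\<close>.\<close>

definition diag_sum :: "nat \<Rightarrow> nat \<Rightarrow> nat" where
  "diag_sum q N = (\<Sum>k = q..N. (Suc N - k) choose (k - 1))"

context
  fixes p :: nat and B :: "nat set"
  assumes p: "p \<ge> 1" and B: "finite B" "B \<noteq> {}"
begin

lemma Max_add_notin: "Max B + p \<notin> B"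
  using p B Max_ge[of B "Max B + p"] by auto

lemma Max_adjoin_above: "Max (adjoin_above p B) = Max B + p"
  using B by (simp add: adjoin_above_def)

text \<open>Both the value of \<open>max2\<close> and the injectivity of
  \<open>adjoin_above p\<close> rest on this left inverse.\<close>

lemma adjoin_above_minus_Max: "adjoin_above p B - {Max (adjoin_above p B)} = B"
  unfolding Max_adjoin_above using Max_add_notin by (auto simp: adjoin_above_def)

lemma max2_adjoin_above: "max2 (adjoin_above p B) = Max B"
  by (simp add: max2_def adjoin_above_minus_Max)

lemma Min_adjoin_above: "Min (adjoin_above p B) = Min B"
proof -
  have "Min B \<le> Max B + p"
    using B Min_le[of B "Max B"] by (simp add: trans_le_add1)
  then show ?thesis
    using B by (simp add: adjoin_above_def)
qed

lemma card_adjoin_above: "card (adjoin_above p B) = Suc (card B)"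
  using B Max_add_notin by (simp add: adjoin_above_def)

end

lemma K_eq_Union:
  assumes p: "p \<ge> 1" and q: "q \<ge> 2"
  shows "K n p q = insert {} (\<Union>k\<in>{q..n - p}.
           adjoin_above p ` {B. B \<subseteq> {k..n - p} \<and> card B = k - 1})"
    (is "_ = insert {} (\<Union>k\<in>_. _ ` ?S k)")
proof (intro set_eqI iffI)
  fix A assume A: "A \<in> K n p q"
  show "A \<in> insert {} (\<Union>k\<in>{q..n - p}. adjoin_above p ` ?S k)"
  proof (cases "A = {}")
    case False
    define B where "B = A - {Max A}"
    have sub: "A \<subseteq> {1..n}" and gap: "Max A - Max B = p" and min: "Min A \<ge> card A"
      and ge: "card A \<ge> q"
      using A False by (auto simp: K_def max2_def B_def)
    have fin: "finite A"
      using sub finite_subset by blast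
    have Max_in: "Max A \<in> A"
      using fin False by simp
    have card_B: "card B = card A - 1"
      using Max_in fin by (simp add: B_def)
    have fin_B: "finite B" "B \<noteq> {}"
      using fin card_B ge q by (simp add: B_def, auto)
    have "Max B \<le> Max A"
      using fin fin_B by (intro Max_mono) (auto simp: B_def)
    \<comment> \<open>\<open>Max B \<le> Max A\<close> makes the subtraction in \<open>gap\<close>
      exact.\<close>
    then have Max_eq: "Max A = Max B + p"
      using gap p by simp
    then have A_eq: "A = adjoin_above p B"
      using Max_in by (auto simp: adjoin_above_def B_def)
    have "Max A \<le> n"
      using Max_in sub by auto
    then have Max_B: "Max B \<le> n - p"
      using Max_eq by simp
    have B_sub: "B \<subseteq> {card A..n - p}"
    proof
      fix x assume x: "x \<in> B"
      have "Min A \<le> x"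
        using x fin by (simp add: B_def)
      moreover have "x \<le> Max B"
        using x fin_B by simp
      ultimately show "x \<in> {card A..n - p}"
        using min Max_B by simp
    qed
    \<comment> \<open>The interval contains the nonempty set \<open>B\<close>, which forces
      \<open>card A \<le> n - p\<close>.\<close>
    then have "card A \<in> {q..n - p}"
      using ge fin_B by fastforce
    then show ?thesis
      using A_eq B_sub card_B by blast
  qed simp
next
  fix A assume "A \<in> insert {} (\<Union>k\<in>{q..n - p}. adjoin_above p ` ?S k)"
  then consider "A = {}" | k B where "k \<in> {q..n - p}" "B \<in> ?S k" "A = adjoin_above p B"
    by blast
  then show "A \<in> K n p q"
  proof cases
    case 2
    have fin: "finite B" "B \<noteq> {}"
      using 2 q finite_subset by auto
    have "Max B \<in> B" "Min B \<in> B"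
      using fin by simp_all
    then have bounds: "Max B \<le> n - p" "Min B \<ge> k"
      using 2 by auto
    \<comment> \<open>Since \<open>2 \<le> q \<le> k \<le> n - p\<close>, the difference
      \<open>n - p\<close> is not truncated.\<close>
    have "Max B + p \<le> n"
      using bounds 2 q by auto
    moreover have "B \<subseteq> {1..n}"
      using 2 q by fastforce
    ultimately have "A \<subseteq> {1..n}"
      using 2 p by (simp add: adjoin_above_def)
    moreover have "card A = k"
      using 2 q by (simp add: card_adjoin_above[OF p fin])
    ultimately show ?thesis
      using 2 bounds
      by (simp add: K_def max2_adjoin_above[OF p fin] Max_adjoin_above[OF p fin]
          Min_adjoin_above[OF p fin])
  qed (simp add: K_def)
qed

lemma card_K:
  assumes p: "p \<ge> 1" and q: "q \<ge> 2"
  shows "card (K n p q) = Suc (diag_sum q (n - p))"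
proof -
  define S where "S k = {B. B \<subseteq> {k..n - p} \<and> card B = k - 1}" for k
  have S: "finite B" "B \<noteq> {}" "card B = k - 1" if "B \<in> S k" "k \<ge> q" for B k
    using that q finite_subset by (auto simp: S_def)
  have inj: "inj_on (adjoin_above p) (S k)" if "k \<ge> q" for k
    by (rule inj_onI) (metis S(1,2) that adjoin_above_minus_Max p)
  have fin: "finite (S k)" for k
    by (simp add: S_def)
  \<comment> \<open>Cardinality separates the images for different \<open>k\<close>, which makes the
    union disjoint.\<close>
  have card_img: "card A = k" if "A \<in> adjoin_above p ` S k" "k \<ge> q" for A k
    using that S[of _ k] q by (auto simp: card_adjoin_above[OF p])
  have empty_notin: "{} \<notin> (\<Union>k\<in>{q..n - p}. adjoin_above p ` S k)"
    by (auto simp: adjoin_above_def)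
  have "card (\<Union>k\<in>{q..n - p}. adjoin_above p ` S k)
      = (\<Sum>k = q..n - p. card (adjoin_above p ` S k))"
  proof (rule card_UN_disjoint)
    show "\<forall>i\<in>{q..n - p}. \<forall>j\<in>{q..n - p}. i \<noteq> j \<longrightarrow>
        adjoin_above p ` S i \<inter> adjoin_above p ` S j = {}"
      using card_img by (metis atLeastAtMost_iff disjoint_iff)
  qed (simp_all add: fin)
  also have "\<dots> = diag_sum q (n - p)"
    unfolding diag_sum_def
  proof (rule sum.cong)
    fix k assume "k \<in> {q..n - p}"
    then have "card (adjoin_above p ` S k) = card (S k)"
      by (intro card_image inj) simp
    also have "\<dots> = (Suc (n - p) - k) choose (k - 1)"
      by (simp add: S_def n_subsets)
    finally show "card (adjoin_above p ` S k) = (Suc (n - p) - k) choose (k - 1)" .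
  qed simp
  finally show ?thesis
    unfolding K_eq_Union[OF p q, of n, folded S_def] using empty_notin fin by simp
qed

text \<open>For \<open>k \<ge> q\<close> the upper index is at most
  \<open>2 * q - 2 - k \<le> k - 2\<close>, hence below the lower index
  \<open>k - 1\<close>.\<close>

lemma diag_sum_eq_0:
  assumes "q \<ge> 2" "N \<le> 2 * q - 3"
  shows "diag_sum q N = 0"
  using assms by (auto simp: diag_sum_def intro!: binomial_eq_0)

lemma diag_sum_rec:
  assumes q: "q \<ge> 2" "q \<le> M + 2"
  shows "diag_sum q (M + 2) = diag_sum q (M + 1) + diag_sum q M + ((M + 2 - q) choose (q - 2))"
proof -
  have "diag_sum q (M + 2)
      = (\<Sum>k = q..M + 2. ((M + 2 - k) choose (k - 2)) + ((M + 2 - k) choose (k - 1)))"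
    unfolding diag_sum_def
  proof (rule sum.cong)
    fix k assume "k \<in> {q..M + 2}"
    then have "Suc (M + 2) - k = Suc (M + 2 - k)" "k - 1 = Suc (k - 2)"
      using q by auto
    then show "(Suc (M + 2) - k) choose (k - 1)
        = ((M + 2 - k) choose (k - 2)) + ((M + 2 - k) choose (k - 1))"
      by simp
  qed simp
  also have "\<dots> = (\<Sum>k = q..M + 2. (M + 2 - k) choose (k - 2))
      + (\<Sum>k = q..M + 2. (M + 2 - k) choose (k - 1))"
    by (rule sum.distrib)
  \<comment> \<open>The extra top term, at \<open>k = M + 2\<close>, is
    \<open>0 choose (M + 1)\<close> and vanishes.\<close>
  also have "(\<Sum>k = q..M + 2. (M + 2 - k) choose (k - 1)) = diag_sum q (M + 1)"
    using q by (simp add: diag_sum_def)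
  also have "(\<Sum>k = q..M + 2. (M + 2 - k) choose (k - 2))
      = ((M + 2 - q) choose (q - 2)) + (\<Sum>k = Suc q..Suc (Suc M). (M + 2 - k) choose (k - 2))"
    using q by (subst sum.atLeast_Suc_atMost) simp_all
  also have "(\<Sum>k = Suc q..Suc (Suc M). (M + 2 - k) choose (k - 2))
      = (\<Sum>k = q..Suc M. (Suc M - k) choose (k - 1))"
    by (subst sum.shift_bounds_cl_Suc_ivl) (simp add: numeral_2_eq_2)
  \<comment> \<open>If \<open>q \<le> Suc M\<close>, the top term is \<open>0 choose M\<close>,
    which vanishes because \<open>q \<ge> 2\<close> forces \<open>M \<ge> 1\<close>. Otherwise both
    sums are empty.\<close>
  also have "\<dots> = diag_sum q M"
    using q by (cases "q \<le> Suc M") (auto simp: diag_sum_def)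
  finally show ?thesis
    by simp
qed

theorem theorem3:
  fixes n p q :: nat
  assumes "p \<ge> 1" and "q \<ge> 2" and "n \<ge> 1"
  shows "int (card (K n p q)) =
    (if n \<le> p + 2 * q - 3 then 1
     else int (card (K (n - 1) p q)) + int (card (K (n - 2) p q))
          + int ((n - p - q) choose (q - 2)) - 1)"
proof (cases "n \<le> p + 2 * q - 3")
  case True
  then have "diag_sum q (n - p) = 0"
    using assms by (intro diag_sum_eq_0) auto
  then show ?thesis
    using True assms by (simp add: card_K)
next
  case False
  \<comment> \<open>Here \<open>n - p \<ge> 2 * q - 2 \<ge> q \<ge> 2\<close>, so the subtractions
    defining \<open>M\<close> are exact.\<close>
  define M where "M = n - p - 2"
  have M: "n - p = M + 2" "n - 1 - p = M + 1" "n - 2 - p = M" "q \<le> M + 2"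
    using False assms by (auto simp: M_def)
  \<comment> \<open>The empty set contributes one to each of the three cardinalities, once on the
    left and twice on the right; the final \<open>- 1\<close> balances this.\<close>
  show ?thesis
    using False diag_sum_rec[OF assms(2) M(4)]
    by (simp only: card_K[OF assms(1,2)] M) simp
qed

end
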